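(* Let $\Gamma$ be a finite simple $k$-regular graph. Then for all sufficiently large $n$, the generalised CAP bound for $\Gamma\,\square\,C_n$ is strictly smaller than the Hoffman bound for $\Gamma\,\square\,C_n$.
   Context: $\Gamma\,\square\,C_n$ is the Cartesian product of $\Gamma$ with the cycle $C_n$ on $n$ vertices. For a finite simple graph $G$ on $v$ vertices, and a positive integer $s$, let $$\mathrm{CA}_G(x,s,\kappa,\lambda):=x(x+1)(v-s)-2xs(\kappa-s+1)+s(s-1)(\lambda-s+2).$$ The edge-degree of an edge is the number of common neighbours of its two endpoints. Let $G$ have at least one edge, let $\delta,\Delta$ be its minimum and maximum vertex degrees, and $\lambda_{\min},\lambda_{\max}$ the minimum and maximum edge-degrees of its edges. For every clique of $G$ with at least two vertices, the average vertex degree in $G$ over the clique lies in $[\delta,\Delta]$ and the average edge-degree in $G$ over pairs of vertices in the clique lies in $[\lambda_{\min},\lambda_{\max}]$. If for every real pair $(\kappa,\lambda)\in[\delta,\Delta]\times[\lambda_{\min},\lambda_{\max}]$ there is an integer $x$ with $\mathrm{CA}_G(x,s,\kappa,\lambda)<0$, then $G$ has no $s$-clique. The generalised CAP bound for $G$ is the least value of $s-1$ over all positive integers $s$ with this property. The Hoffman bound for a $d$-regular graph $G$ on $v$ vertices is the real number $\dfrac{v(1+\gamma_2)}{v-d+\gamma_2}$, where $\gamma_2$ is the second-largest eigenvalue (counted with multiplicity) of the adjacency matrix of $G$. *)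

theory Defs
  imports "Graph_Theory.Graph_Theory" "Jordan_Normal_Form.Char_Poly"
begin

text \<open>
  A finite simple graph is a \<^locale>\<open>pair_graph\<close>: finite, loop-free and symmetric, an undirected
  edge \<open>uv\<close> being the pair of arcs \<open>(u, v)\<close> and \<open>(v, u)\<close>. Hence the degree of a vertex is its
  \<^const>\<open>out_degree\<close>.
\<close>

definition regular_graph :: "nat \<Rightarrow> 'a pair_pre_digraph \<Rightarrow> bool" where
  "regular_graph d G \<longleftrightarrow> pair_graph G \<and> (\<forall>v \<in> pverts G. out_degree G v = d)"

text \<open>This is the cycle on \<open>n\<close> vertices for \<open>n \<ge> 3\<close> only; for \<open>n = 1\<close> it has a loop.\<close>

definition cycle_graph :: "nat \<Rightarrow> nat pair_pre_digraph" where
  "cycle_graph n = \<lparr> pverts = {0..<n},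
     parcs = {(i, j). i < n \<and> j < n \<and> (j = Suc i mod n \<or> i = Suc j mod n)} \<rparr>"

definition cartesian_product ::
  "'a pair_pre_digraph \<Rightarrow> 'b pair_pre_digraph \<Rightarrow> ('a \<times> 'b) pair_pre_digraph" (infixr \<open>\<box>\<close> 70) where
  "G \<box> H = \<lparr> pverts = pverts G \<times> pverts H,
     parcs = {((u, x), (v, y)). u = v \<and> u \<in> pverts G \<and> (x, y) \<in> parcs H
                              \<or> (u, v) \<in> parcs G \<and> x = y \<and> x \<in> pverts H} \<rparr>"


subsection \<open>The generalised CAP bound\<close>

definition edge_degree :: "'a pair_pre_digraph \<Rightarrow> 'a \<times> 'a \<Rightarrow> nat" where
  "edge_degree G e = card {w. (fst e, w) \<in> parcs G \<and> (snd e, w) \<in> parcs G}"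

definition min_degree :: "'a pair_pre_digraph \<Rightarrow> nat" where
  "min_degree G = Min (out_degree G ` pverts G)"

definition max_degree :: "'a pair_pre_digraph \<Rightarrow> nat" where
  "max_degree G = Max (out_degree G ` pverts G)"

text \<open>The next two are meaningful only for graphs with at least one edge.\<close>

definition min_edge_degree :: "'a pair_pre_digraph \<Rightarrow> nat" where
  "min_edge_degree G = Min (edge_degree G ` parcs G)"

definition max_edge_degree :: "'a pair_pre_digraph \<Rightarrow> nat" where
  "max_edge_degree G = Max (edge_degree G ` parcs G)"

definition clique_adjacency :: "'a pair_pre_digraph \<Rightarrow> int \<Rightarrow> nat \<Rightarrow> real \<Rightarrow> real \<Rightarrow> real" where
  "clique_adjacency G x s \<kappa> lam =
     real_of_int x * (real_of_int x + 1) * (real (card (pverts G)) - real s)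
     - 2 * real_of_int x * real s * (\<kappa> - real s + 1)
     + real s * (real s - 1) * (lam - real s + 2)"

definition cap_excludes :: "'a pair_pre_digraph \<Rightarrow> nat \<Rightarrow> bool" where
  "cap_excludes G s \<longleftrightarrow>
     (\<forall>\<kappa> \<in> {real (min_degree G)..real (max_degree G)}.
      \<forall>lam \<in> {real (min_edge_degree G)..real (max_edge_degree G)}.
        \<exists>x::int. clique_adjacency G x s \<kappa> lam < 0)"

text \<open>
  The set over which the least value is taken is never empty: for \<open>s > card (pverts G)\<close> the
  coefficient of \<open>x\<^sup>2\<close> in \<^const>\<open>clique_adjacency\<close> is negative.
\<close>

definition generalised_cap_bound :: "'a pair_pre_digraph \<Rightarrow> nat" where
  "generalised_cap_bound G = (LEAST b. \<exists>s. s > 0 \<and> cap_excludes G s \<and> b = s - 1)"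


subsection \<open>The Hoffman bound\<close>

definition adjacency_mat :: "'a pair_pre_digraph \<Rightarrow> 'a list \<Rightarrow> real mat" where
  "adjacency_mat G vs =
     mat (length vs) (length vs) (\<lambda>(i, j). if (vs ! i, vs ! j) \<in> parcs G then 1 else 0)"

text \<open>
  The eigenvalues are the roots of the characteristic polynomial, each with its multiplicity. As
  the matrix is real symmetric, all of them are real and algebraic and geometric multiplicities
  agree. The enumeration of the vertices is immaterial, see \<open>adjacency_eigenvalues_eq\<close> below.
\<close>

definition adjacency_eigenvalues :: "'a pair_pre_digraph \<Rightarrow> real multiset" where
  "adjacency_eigenvalues G =
     proots (char_poly (adjacency_mat G (SOME vs. distinct vs \<and> set vs = pverts G)))"

definition second_largest_eigenvalue :: "'a pair_pre_digraph \<Rightarrow> real" where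
  "second_largest_eigenvalue G = rev (sorted_list_of_multiset (adjacency_eigenvalues G)) ! 1"

definition hoffman_bound :: "'a pair_pre_digraph \<Rightarrow> real" where
  "hoffman_bound G =
     (let v = real (card (pverts G)); d = real (THE d. regular_graph d G);
          \<gamma>\<^sub>2 = second_largest_eigenvalue G
      in v * (1 + \<gamma>\<^sub>2) / (v - d + \<gamma>\<^sub>2))"

lemma char_poly_adjacency_mat_unique:
  assumes vs: "distinct vs" and ws: "distinct ws" and eq: "set vs = set ws"
  shows "char_poly (adjacency_mat G vs) = char_poly (adjacency_mat G ws)"
proof -
  define n where "n = length vs"
  have lw: "length ws = n" using vs ws eq distinct_card n_def by metis
  have "mset vs = mset ws" using vs ws eq set_eq_iff_mset_eq_distinct by blast
  then obtain p where p: "p permutes {..<length vs}" and pl: "permute_list p vs = ws"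
    using mset_eq_permutation by metis
  have p0: "p permutes {0..<n}" using p by (simp add: n_def atLeast0LessThan)
  have wi: "ws ! i = vs ! p i" if "i < n" for i
    using permute_list_nth[OF p] pl that n_def by metis
  have pn: "p i < n" if "i < n" for i using p0 that permutes_in_image by fastforce
  have pinj: "p i = p j \<longleftrightarrow> i = j" for i j using p0 permutes_inj injD by metis
  define C where "C = char_poly_matrix (adjacency_mat G vs)"
  define D where "D = char_poly_matrix (adjacency_mat G ws)"
  define R where "R = mat n n (\<lambda>(i, j). C $$ (p i, j))"
  have C: "C \<in> carrier_mat n n" and R: "R \<in> carrier_mat n n"
    by (auto simp: C_def R_def char_poly_matrix_def adjacency_mat_def n_def)
  have D: "D = mat n n (\<lambda>(i, j). R $$ (i, p j))"
    by (rule eq_matI)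
       (auto simp: D_def R_def C_def char_poly_matrix_def adjacency_mat_def wi pn pinj lw n_def[symmetric])
  have DT: "D\<^sup>T = mat n n (\<lambda>(i, j). R\<^sup>T $$ (p i, j))"
    by (rule eq_matI) (use R in \<open>auto simp: D pn\<close>)
  have "D \<in> carrier_mat n n" by (simp add: D)
  then have "det D = det D\<^sup>T" by (simp add: det_transpose)
  also have "\<dots> = signof p * det R\<^sup>T" unfolding DT
    by (rule det_permute_rows[OF _ p0]) (use R in simp)
  also have "det R\<^sup>T = det R" by (rule det_transpose[OF R])
  also have "det R = signof p * det C" unfolding R_def by (rule det_permute_rows[OF C p0])
  also have "signof p * (signof p * det C) = det C" by (simp add: sign_def)
  finally show ?thesis by (simp add: char_poly_def C_def D_def)
qed

lemma adjacency_eigenvalues_eq: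
  assumes "distinct vs" and "set vs = pverts G"
  shows "adjacency_eigenvalues G = proots (char_poly (adjacency_mat G vs))"
proof -
  let ?ws = "SOME vs. distinct vs \<and> set vs = pverts G"
  have "distinct ?ws \<and> set ?ws = pverts G"
    by (rule someI[of _ vs]) (use assms in simp)
  then show ?thesis
    using char_poly_adjacency_mat_unique[of ?ws vs G] assms
    by (simp add: adjacency_eigenvalues_def)
qed

end

theory Submission
  imports Defs
begin

text \<open>
  The graph \<open>\<Gamma> \<box> C\<^sub>n\<close> is \<open>(k + 2)\<close>-regular, and at \<open>s = k + 3\<close> and \<open>x = 0\<close> its clique
  adjacency polynomial has the value \<open>(k + 3) (k + 2) (\<lambda> - k - 1)\<close>. Edge-degrees are at most \<open>k\<close>
  once \<open>n \<ge> 4\<close>, hence the CAP bound is at most \<open>k + 2\<close>. On the other hand \<open>k + 2\<close> and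
  \<open>k + 2 cos (2\<pi>/n)\<close> are distinct eigenvalues and both exceed \<open>k + 1\<close> for \<open>n \<ge> 7\<close>; and
  \<open>\<gamma>\<^sub>2 > k + 1\<close> is all that is needed for the Hoffman bound to exceed \<open>k + 2\<close> when \<open>v > k + 2\<close>.
\<close>

section \<open>Cartesian products with cycles\<close>

lemma out_degree_eq_card_Image: "out_degree (with_proj G) v = card (parcs G `` {v})"
proof -
  have "out_arcs (with_proj G) v = Pair v ` (parcs G `` {v})"
    by (auto simp: out_arcs_def)
  then show ?thesis
    by (simp add: out_degree_def card_image inj_on_def)
qed

text \<open>Reduces regularity to facts about the arc relation, with degrees as sizes of its images,
  so that explicitly given graphs can be checked by set reasoning.\<close>

lemma regular_graphI:
  assumes "finite (pverts G)" and "parcs G \<subseteq> pverts G \<times> pverts G"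
    and "sym (parcs G)" and "irrefl (parcs G)"
    and "\<And>v. v \<in> pverts G \<Longrightarrow> card (parcs G `` {v}) = d"
  shows "regular_graph d G"
proof -
  have "finite (parcs G)"
    using assms(1,2) by (meson finite_SigmaI finite_subset)
  then have "pair_graph G"
    using assms by unfold_locales (auto simp: symmetric_def irrefl_def)
  then show ?thesis
    using assms(5) by (simp add: regular_graph_def out_degree_eq_card_Image)
qed

lemma regular_graphD:
  assumes "regular_graph d G"
  shows "finite (pverts G)" and "finite (parcs G)" and "parcs G \<subseteq> pverts G \<times> pverts G"
    and "sym (parcs G)" and "irrefl (parcs G)"
    and "\<And>v. v \<in> pverts G \<Longrightarrow> card (parcs G `` {v}) = d"
proof -
  interpret pair_graph G using assms by (simp add: regular_graph_def)
  show "finite (pverts G)" "finite (parcs G)"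
    by (fact pair_finite_verts pair_finite_arcs)+
  show "parcs G \<subseteq> pverts G \<times> pverts G"
    by (auto dest: in_arcsD1 in_arcsD2)
  show "sym (parcs G)" using pair_sym_arcs by (simp add: symmetric_def)
  show "irrefl (parcs G)" using pair_no_loops by (fastforce simp: irrefl_def)
  show "card (parcs G `` {v}) = d" if "v \<in> pverts G" for v
    using assms that by (simp add: regular_graph_def out_degree_eq_card_Image)
qed

lemma pverts_cartesian_product [simp]: "pverts (G \<box> H) = pverts G \<times> pverts H"
  by (simp add: cartesian_product_def)

lemma Image_cartesian_product:
  assumes "u \<in> pverts G" and "x \<in> pverts H"
  shows "parcs (G \<box> H) `` {(u, x)} = {u} \<times> parcs H `` {x} \<union> parcs G `` {u} \<times> {x}"
  using assms by (auto simp: cartesian_product_def)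

lemma regular_graph_cartesian_product:
  assumes G: "regular_graph d G" and H: "regular_graph e H"
  shows "regular_graph (d + e) (G \<box> H)"
proof (rule regular_graphI)
  note g = regular_graphD[OF G] and h = regular_graphD[OF H]
  show "finite (pverts (G \<box> H))" using g h by simp
  show "parcs (G \<box> H) \<subseteq> pverts (G \<box> H) \<times> pverts (G \<box> H)"
    using g(3) h(3) by (auto simp: cartesian_product_def)
  show "sym (parcs (G \<box> H))"
    using g(4) h(4) by (auto simp: cartesian_product_def sym_def)
  show "irrefl (parcs (G \<box> H))"
    using g(5) h(5) by (auto simp: cartesian_product_def irrefl_def)
  fix p assume "p \<in> pverts (G \<box> H)"
  then obtain u x where p: "p = (u, x)" and u: "u \<in> pverts G" and x: "x \<in> pverts H"
    by auto
  have "finite (parcs G `` {u})" "finite (parcs H `` {x})"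
    using g(2) h(2) by (auto intro: finite_Image)
  \<comment> \<open>Loop-freeness keeps the two parts of the neighbourhood disjoint: only steps in
    \<open>H\<close> fix the first coordinate.\<close>
  moreover have "u \<notin> parcs G `` {u}" using g(5) by (auto simp: irrefl_def)
  ultimately have "card ({u} \<times> parcs H `` {x} \<union> parcs G `` {u} \<times> {x})
      = card ({u} \<times> parcs H `` {x}) + card (parcs G `` {u} \<times> {x})"
    by (intro card_Un_disjoint) auto
  then show "card (parcs (G \<box> H) `` {p}) = d + e"
    using g(6)[OF u] h(6)[OF x] by (simp add: p Image_cartesian_product u x card_cartesian_product)
qed

lemma pverts_cycle_graph [simp]: "pverts (cycle_graph n) = {0..<n}"
  by (simp add: cycle_graph_def)

text \<open>With \<open>mod\<close> resolved into the two wrap-around cases, adjacency on the cycle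
  becomes linear arithmetic.\<close>

lemma parcs_cycle_graph: "parcs (cycle_graph n) = {(i, j). i < n \<and> j < n \<and>
    (j = Suc i \<or> i = Suc j \<or> Suc i = n \<and> j = 0 \<or> Suc j = n \<and> i = 0)}"
proof -
  have "j = Suc i mod n \<longleftrightarrow> j = Suc i \<or> Suc i = n \<and> j = 0" if "i < n" "j < n" for i j
    using that by (cases "Suc i = n") auto
  then have "parcs (cycle_graph n) = {(i, j). i < n \<and> j < n \<and>
      ((j = Suc i \<or> Suc i = n \<and> j = 0) \<or> (i = Suc j \<or> Suc j = n \<and> i = 0))}"
    by (simp add: cycle_graph_def cong: conj_cong)
  then show ?thesis by (simp add: disj_ac)
qed

lemma Image_cycle_graph:
  assumes "n \<ge> 2" and "x < n"
  shows "parcs (cycle_graph n) `` {x} =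
    {if Suc x = n then 0 else Suc x, if x = 0 then n - 1 else x - 1}"
  using assms by (cases "x = 0"; cases "Suc x = n") (auto simp: parcs_cycle_graph)

lemma regular_graph_cycle_graph:
  assumes "n \<ge> 3"
  shows "regular_graph 2 (cycle_graph n)"
proof (rule regular_graphI)
  show "irrefl (parcs (cycle_graph n))"
    using assms by (auto simp: parcs_cycle_graph irrefl_def)
  show "card (parcs (cycle_graph n) `` {x}) = 2" if "x \<in> pverts (cycle_graph n)" for x
    using that assms by (auto simp: Image_cycle_graph card_insert_if)
qed (auto simp: parcs_cycle_graph sym_def)

text \<open>Going round a triangle adds three steps of 1 or -1 to a multiple of \<open>n\<close>;
  the sum is one of -3, -1, 1, 3, none of which is divisible by \<open>n \<ge> 4\<close>.\<close>

lemma cycle_graph_triangle_free: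
  assumes "n \<ge> 4" and "(x, y) \<in> parcs (cycle_graph n)" and "(x, z) \<in> parcs (cycle_graph n)"
  shows "(y, z) \<notin> parcs (cycle_graph n)"
  using assms unfolding parcs_cycle_graph mem_Collect_eq prod.case by linarith

text \<open>The endpoints of an edge coming from \<open>H\<close> have no common neighbour, as
  \<open>H\<close> has no triangles. For an edge coming from \<open>G\<close>, all common neighbours
  lie in the same copy of \<open>G\<close>, among the \<open>k\<close> neighbours of an endpoint
  there.\<close>

lemma edge_degree_cartesian_product_le:
  assumes G: "regular_graph k G" and H: "regular_graph d H"
    and tf: "\<And>x y z. (x, y) \<in> parcs H \<Longrightarrow> (x, z) \<in> parcs H \<Longrightarrow> (y, z) \<notin> parcs H"
    and e: "e \<in> parcs (G \<box> H)"
  shows "edge_degree (G \<box> H) e \<le> k"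
proof -
  note g = regular_graphD[OF G] and h = regular_graphD[OF H]
  obtain u x v y where e': "e = ((u, x), (v, y))"
    by (metis prod.collapse)
  have u: "u \<in> pverts G" using e g(3) by (auto simp: e' cartesian_product_def)
  have "{w. (fst e, w) \<in> parcs (G \<box> H) \<and> (snd e, w) \<in> parcs (G \<box> H)} \<subseteq> parcs G `` {u} \<times> {x}"
    using e tf g(5) h(5) by (auto simp: e' cartesian_product_def irrefl_def)
  moreover have "finite (parcs G `` {u} \<times> {x})" using g(2) by (auto intro: finite_Image)
  ultimately have "edge_degree (G \<box> H) e \<le> card (parcs G `` {u} \<times> {x})"
    unfolding edge_degree_def by (rule card_mono[rotated])
  then show ?thesis using g(6)[OF u] by (simp add: card_cartesian_product)
qed


section \<open>The CAP bound\<close>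

text \<open>At \<open>x = 0\<close> the clique adjacency polynomial reduces to its last term, which
  for \<open>s = d + 1\<close> is \<open>(d + 1) * d * (lam + 1 - d)\<close>. The strict bound on
  edge-degrees makes the last factor negative and forces \<open>d > 0\<close>.\<close>

lemma generalised_cap_bound_le_degree:
  assumes G: "regular_graph d G" and ne: "parcs G \<noteq> {}"
    and le: "\<And>e. e \<in> parcs G \<Longrightarrow> Suc (edge_degree G e) < d"
  shows "generalised_cap_bound G \<le> d"
proof -
  note g = regular_graphD[OF G]
  from ne obtain e where e: "e \<in> parcs G" by blast
  have "out_degree G ` pverts G = {d}"
    using g(3) e G by (force simp: regular_graph_def image_def)
  then have deg: "min_degree G = d" "max_degree G = d"
    by (simp_all add: min_degree_def max_degree_def)
  have "max_edge_degree G \<in> edge_degree G ` parcs G"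
    unfolding max_edge_degree_def using g(2) ne by (intro Max_in) auto
  then have max: "Suc (max_edge_degree G) < d"
    using le by auto
  have "cap_excludes G (Suc d)"
    unfolding cap_excludes_def deg
  proof (intro ballI exI[of _ "0 :: int"])
    fix \<kappa> lam
    assume "lam \<in> {real (min_edge_degree G)..real (max_edge_degree G)}"
    then have "lam + 1 < real d" using max by auto
    then have "real (Suc d) * real d * (lam + 1 - real d) < 0"
      using max by (intro mult_pos_neg) auto
    then show "clique_adjacency G 0 (Suc d) \<kappa> lam < 0"
      by (simp add: clique_adjacency_def algebra_simps)
  qed
  then show ?thesis
    unfolding generalised_cap_bound_def by (intro Least_le exI[of _ "Suc d"]) auto
qed


section \<open>The Hoffman bound\<close>

text \<open>Lets eigenvalues be found without matrices: a function on the vertices, read along an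
  enumeration, becomes an eigenvector.\<close>

lemma adjacency_eigenvalueI:
  fixes f :: "'a \<Rightarrow> real"
  assumes fin: "finite (pverts G)" and arcs: "parcs G \<subseteq> pverts G \<times> pverts G"
    and eig: "\<And>u. u \<in> pverts G \<Longrightarrow> (\<Sum>w\<in>parcs G `` {u}. f w) = \<mu> * f u"
    and nz: "u\<^sub>0 \<in> pverts G" "f u\<^sub>0 \<noteq> 0"
  shows "\<mu> \<in># adjacency_eigenvalues G"
proof -
  obtain vs where vs: "distinct vs" "set vs = pverts G"
    using finite_distinct_list[OF fin] by blast
  define n where "n = length vs"
  define A where "A = adjacency_mat G vs"
  define x where "x = vec n (\<lambda>i. f (vs ! i))"
  have A: "A \<in> carrier_mat n n"
    by (simp add: A_def adjacency_mat_def n_def)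
  have "A *\<^sub>v x = \<mu> \<cdot>\<^sub>v x"
  proof (rule eq_vecI)
    fix i assume "i < dim_vec (\<mu> \<cdot>\<^sub>v x)"
    then have i: "i < n" by (simp add: x_def)
    then have vi: "vs ! i \<in> pverts G" using vs n_def by (metis nth_mem)
    have "(A *\<^sub>v x) $ i = (\<Sum>j = 0..<n. A $$ (i, j) * x $ j)"
      using A i by (simp add: scalar_prod_def x_def)
    also have "\<dots> = (\<Sum>j = 0..<n. if (vs ! i, vs ! j) \<in> parcs G then f (vs ! j) else 0)"
      using i by (intro sum.cong) (simp_all add: A_def adjacency_mat_def x_def n_def [symmetric])
    also have "\<dots> = (\<Sum>w\<in>pverts G. if (vs ! i, w) \<in> parcs G then f w else 0)"
      using vs by (intro sum.reindex_bij_betw)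
        (simp add: bij_betw_nth n_def atLeast0LessThan)
    also have "\<dots> = (\<Sum>w\<in>parcs G `` {vs ! i}. f w)"
      using arcs by (intro sum.mono_neutral_cong_right) (auto simp: fin)
    finally show "(A *\<^sub>v x) $ i = (\<mu> \<cdot>\<^sub>v x) $ i"
      using eig[OF vi] i by (simp add: x_def)
  qed (use A in \<open>simp add: x_def\<close>)
  moreover have "x \<noteq> 0\<^sub>v n"
  proof
    assume "x = 0\<^sub>v n"
    moreover obtain i where "i < n" "vs ! i = u\<^sub>0"
      using nz(1) vs n_def by (metis in_set_conv_nth)
    ultimately show False using nz(2) by (auto simp: x_def dest: arg_cong[where f = "\<lambda>v. v $ i"])
  qed
  ultimately have "eigenvalue A \<mu>"
    using A unfolding eigenvalue_def eigenvector_def by (intro exI[of _ x]) (simp add: x_def)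
  then have "poly (char_poly A) \<mu> = 0"
    using eigenvalue_root_char_poly[OF A] by simp
  \<comment> \<open>\<open>proots\<close> of the zero polynomial is empty, so a root is a member
    only once the polynomial is known to be nonzero; being monic ensures this.\<close>
  moreover have "char_poly A \<noteq> 0"
    using degree_monic_char_poly[OF A] by auto
  ultimately show ?thesis
    by (simp add: adjacency_eigenvalues_eq[OF vs] A_def)
qed

text \<open>Two distinct eigenvalues occupy two positions of the sorted list, so its last but one
  entry is at least the smaller of them, whatever the multiplicities.\<close>

lemma less_second_largest_eigenvalue:
  assumes "a \<in># adjacency_eigenvalues G" and "b \<in># adjacency_eigenvalues G"
    and "a < b" and "c < a"
  shows "c < second_largest_eigenvalue G"
proof -
  define l where "l = sorted_list_of_multiset (adjacency_eigenvalues G)"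
  have l: "sorted l" "set l = set_mset (adjacency_eigenvalues G)"
    by (simp_all add: l_def)
  obtain i j where ij: "i < length l" "l ! i = a" "j < length l" "l ! j = b"
    using assms(1,2) l(2) by (metis in_set_conv_nth)
  have "i < j"
    using l(1) ij assms(3) by (metis leD leI sorted_nth_mono)
  then have "a \<le> l ! (length l - 2)"
    using ij l(1) sorted_nth_mono[of l i "length l - 2"] by simp
  moreover have "rev l ! 1 = l ! (length l - 2)"
    using \<open>i < j\<close> ij by (simp add: rev_nth numeral_2_eq_2)
  ultimately show ?thesis
    using assms(4) by (simp add: second_largest_eigenvalue_def l_def)
qed

text \<open>With \<open>N\<close> vertices and second-largest eigenvalue \<open>\<gamma>\<close>,
  clearing the denominator leaves the difference \<open>(N - d) * (\<gamma> - (d - 1)) + d\<close>,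
  a positive product plus a nonnegative term.\<close>

lemma hoffman_bound_gt_degree:
  assumes G: "regular_graph d G" and card: "card (pverts G) > d"
    and gt: "second_largest_eigenvalue G > real d - 1"
  shows "hoffman_bound G > real d"
proof -
  from card obtain v where v: "v \<in> pverts G" by fastforce
  \<comment> \<open>The vertex \<open>v\<close> makes the degree unique: a graph without vertices is
    regular of every degree.\<close>
  have "(THE e. regular_graph e G) = d"
    using G v by (intro the_equality) (auto simp: regular_graph_def)
  moreover have "real d * (real (card (pverts G)) - d + second_largest_eigenvalue G)
      < real (card (pverts G)) * (1 + second_largest_eigenvalue G)"
  proof -
    have "real d * (second_largest_eigenvalue G - (real d - 1))
        < real (card (pverts G)) * (second_largest_eigenvalue G - (real d - 1))"
      using gt card by (intro mult_strict_right_mono) auto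
    then show ?thesis by (simp add: algebra_simps)
  qed
  \<comment> \<open>The vertex count is an integer, so it exceeds \<open>d\<close> by at least 1,
    while the eigenvalue is above \<open>d - 1 \<ge> -1\<close>.\<close>
  moreover have "real (card (pverts G)) - d + second_largest_eigenvalue G > 0"
    using card gt by linarith
  ultimately show ?thesis
    by (simp add: hoffman_bound_def Let_def pos_less_divide_eq)
qed

text \<open>The eigenfunction is \<open>h\<close> of the second coordinate, constant on each copy of
  \<open>G\<close>; the \<open>k\<close> neighbours inside a copy repeat the value at the vertex and
  so add \<open>k\<close> to the eigenvalue.\<close>

lemma cartesian_product_eigenvalue:
  fixes h :: "'b \<Rightarrow> real"
  assumes G: "regular_graph k G" and H: "regular_graph d H"
    and eig: "\<And>x. x \<in> pverts H \<Longrightarrow> (\<Sum>y\<in>parcs H `` {x}. h y) = \<mu> * h x"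
    and nz: "u\<^sub>0 \<in> pverts G" "x\<^sub>0 \<in> pverts H" "h x\<^sub>0 \<noteq> 0"
  shows "k + \<mu> \<in># adjacency_eigenvalues (G \<box> H)"
proof (rule adjacency_eigenvalueI)
  note g = regular_graphD[OF G] and h = regular_graphD[OF H]
    and gh = regular_graphD[OF regular_graph_cartesian_product[OF G H]]
  show "finite (pverts (G \<box> H))" "parcs (G \<box> H) \<subseteq> pverts (G \<box> H) \<times> pverts (G \<box> H)"
    by (fact gh)+
  show "(u\<^sub>0, x\<^sub>0) \<in> pverts (G \<box> H)" "(h \<circ> snd) (u\<^sub>0, x\<^sub>0) \<noteq> 0"
    using nz by simp_all
  fix p assume "p \<in> pverts (G \<box> H)"
  then obtain u x where p: "p = (u, x)" and u: "u \<in> pverts G" and x: "x \<in> pverts H"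
    by auto
  have fin: "finite (parcs G `` {u})" "finite (parcs H `` {x})"
    using g(2) h(2) by (auto intro: finite_Image)
  have "u \<notin> parcs G `` {u}" using g(5) by (auto simp: irrefl_def)
  then have "(\<Sum>w\<in>parcs (G \<box> H) `` {p}. (h \<circ> snd) w)
      = (\<Sum>w\<in>{u} \<times> parcs H `` {x}. h (snd w)) + (\<Sum>w\<in>parcs G `` {u} \<times> {x}. h (snd w))"
    unfolding p Image_cartesian_product[OF u x] using fin
    by (subst sum.union_disjoint) auto
  also have "(\<Sum>w\<in>{u} \<times> parcs H `` {x}. h (snd w)) = \<mu> * h x"
    using eig[OF x] by (simp add: sum.cartesian_product' case_prod_unfold)
  also have "(\<Sum>w\<in>parcs G `` {u} \<times> {x}. h (snd w)) = k * h x"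
    using g(6)[OF u] by (simp add: sum.cartesian_product' case_prod_unfold)
  finally show "(\<Sum>w\<in>parcs (G \<box> H) `` {p}. (h \<circ> snd) w) = (k + \<mu>) * (h \<circ> snd) p"
    by (simp add: p algebra_simps)
qed

text \<open>This is \<open>cos (a + t) + cos (a - t) = 2 * cos t * cos a\<close> with
  \<open>a = x * t\<close>; as \<open>n * t = 2 * pi\<close>, periodicity carries it across the
  wrap-around.\<close>

lemma cycle_graph_cos_eigenfunction:
  fixes n :: nat and t :: real
  defines "t \<equiv> 2 * pi / n"
  assumes n: "n \<ge> 3" and x: "x < n"
  shows "(\<Sum>y\<in>parcs (cycle_graph n) `` {x}. cos (y * t)) = 2 * cos t * cos (x * t)"
proof -
  have nt: "n * t = 2 * pi" using n by (simp add: t_def)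
  define a where "a = (if Suc x = n then 0 else Suc x)"
  define b where "b = (if x = 0 then n - 1 else x - 1)"
  \<comment> \<open>The sum runs over a set, so the two neighbours must differ; for
    \<open>n = 2\<close> they would coincide.\<close>
  have "a \<noteq> b" using n by (auto simp: a_def b_def split: if_splits)
  then have "(\<Sum>y\<in>parcs (cycle_graph n) `` {x}. cos (y * t)) = cos (a * t) + cos (b * t)"
    using Image_cycle_graph[of n x] n x by (simp add: a_def b_def)
  also have "cos (a * t) = cos (x * t + t)"
  proof (cases "Suc x = n")
    case True
    then have "x * t + t = 2 * pi" using nt by (auto simp: algebra_simps)
    then show ?thesis using True by (simp add: a_def)
  qed (simp add: a_def algebra_simps)
  also have "cos (b * t) = cos (x * t - t)"
  proof (cases "x = 0")
    case True
    then have "b * t = 2 * pi - t" using nt n by (simp add: b_def of_nat_diff algebra_simps)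
    then show ?thesis using True by (simp add: cos_diff)
  qed (simp add: b_def of_nat_diff algebra_simps)
  finally show ?thesis by (simp add: cos_add cos_diff)
qed

theorem theorem5p8:
  fixes \<Gamma> :: "'a pair_pre_digraph" and k :: nat
  assumes "regular_graph k \<Gamma>" and "pverts \<Gamma> \<noteq> {}"
  shows "\<forall>\<^sub>F n in sequentially.
    real (generalised_cap_bound (\<Gamma> \<box> cycle_graph n)) < hoffman_bound (\<Gamma> \<box> cycle_graph n)"
proof (rule eventually_sequentiallyI)
  \<comment> \<open>The summand \<open>k\<close> puts the vertex count above the degree
    \<open>k + 2\<close>; the 7 gives \<open>2 * pi / n < pi / 3\<close> and also covers
    \<open>n \<ge> 4\<close> for triangle-freeness.\<close>
  fix n assume n: "n \<ge> k + 7"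
  note G = assms(1)
  define P where "P = \<Gamma> \<box> cycle_graph n"
  from assms(2) obtain u where u: "u \<in> pverts \<Gamma>" by blast
  have C: "regular_graph 2 (cycle_graph n)"
    using n by (intro regular_graph_cycle_graph) simp
  have P: "regular_graph (k + 2) P"
    unfolding P_def by (rule regular_graph_cartesian_product[OF G C])
  have uP: "(u, 0) \<in> pverts P" using u n by (simp add: P_def)
  have "generalised_cap_bound P \<le> k + 2"
  proof (rule generalised_cap_bound_le_degree[OF P])
    show "parcs P \<noteq> {}" using regular_graphD(6)[OF P uP] by auto
    have "edge_degree P e \<le> k" if "e \<in> parcs P" for e
      unfolding P_def using that n
      by (intro edge_degree_cartesian_product_le[OF G C] cycle_graph_triangle_free)
        (auto simp: P_def)
    then show "Suc (edge_degree P e) < k + 2" if "e \<in> parcs P" for e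
      using that by fastforce
  qed
  moreover have "real (k + 2) < hoffman_bound P"
  proof (rule hoffman_bound_gt_degree[OF P])
    have "card (pverts P) = card (pverts \<Gamma>) * n"
      by (simp add: P_def card_cartesian_product)
    moreover have "n \<le> card (pverts \<Gamma>) * n"
      using regular_graphD(1)[OF G] assms(2) by (simp add: card_gt_0_iff Suc_leI)
    ultimately show "k + 2 < card (pverts P)"
      using n by linarith
    define t where "t = 2 * pi / real n"
    have "t > 0" "t < pi / 3"
      using n by (auto simp: t_def field_simps)
    \<comment> \<open>The lower bound places \<open>k + 2 * cos t\<close> above
      \<open>k + 1\<close>; the upper bound keeps it apart from the eigenvalue
      \<open>k + 2\<close>.\<close>
    then have "1 / 2 < cos t" "cos t < 1"
      using cos_monotone_0_pi[of t "pi / 3"] cos_monotone_0_pi[of 0 t] by (auto simp: cos_60)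
    moreover have "k + 2 * cos t \<in># adjacency_eigenvalues P"
      unfolding P_def
    proof (rule cartesian_product_eigenvalue[OF G C _ u, where x\<^sub>0 = 0])
      show "(\<Sum>y\<in>parcs (cycle_graph n) `` {x}. cos (y * t)) = 2 * cos t * cos (x * t)"
        if "x \<in> pverts (cycle_graph n)" for x
        using that n cycle_graph_cos_eigenfunction[of n x] by (simp add: t_def)
    qed (use n in auto)
    \<comment> \<open>The constant function is an eigenfunction of the 2-regular cycle, with
      eigenvalue 2.\<close>
    moreover have "real k + 2 \<in># adjacency_eigenvalues P"
      unfolding P_def
      by (rule cartesian_product_eigenvalue[OF G C _ u, where x\<^sub>0 = 0 and h = "\<lambda>_. 1"])
        (use n regular_graphD(6)[OF C] in auto)
    ultimately show "real (k + 2) - 1 < second_largest_eigenvalue P"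
      by (intro less_second_largest_eigenvalue[of "k + 2 * cos t" _ "real k + 2"]) auto
  qed
  ultimately show "real (generalised_cap_bound (\<Gamma> \<box> cycle_graph n))
      < hoffman_bound (\<Gamma> \<box> cycle_graph n)"
    by (simp add: P_def)
qed

end
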